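(* Let $\mathcal{Z}\subset\mathbb{R}^{d}$ be non-empty and compact with $0\notin\operatorname{conv}(\mathcal{Z})$, let $\ell(z,f)=z^{\mathsf T}f$, and let $\mathcal{F}=\{f\in\mathbb{R}^d\mid\|f\|_{\mathcal{F}}\le C\}$, where $C\ge0$ and $\|\cdot\|_{\mathcal{F}}$ is a $q$-uniformly convex norm on $\mathbb{R}^d$. Then the Follow-The-Leader strategy yields regret $O(\log T)$ if $q=2$, and regret $O\big(T^{\frac{q-2}{q-1}}\big)$ if $q\in(2,3]$. That is, there is a constant $K>0$ such that for every integer $T\ge2$, every sequence $z_1,\dots,z_T\in\mathcal{Z}$, and every sequence $f_1,\dots,f_T$ played by Follow-The-Leader against it, $r_T((z_t)_{t=1,\dots,T},(f_t)_{t=1,\dots,T})$ is at most $K\log T$ if $q=2$, and at most $K\,T^{\frac{q-2}{q-1}}$ if $q\in(2,3]$.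
   Context: $\operatorname{conv}$ denotes the convex hull. Modulus of convexity of the unit ball of a norm $\|\cdot\|_{\mathcal{F}}$: $$\delta_{\mathcal{F}}(\epsilon)=\inf\Big\{1-\Big\|\frac{f+\tilde f}{2}\Big\|_{\mathcal{F}} \;\Big|\; \|f\|_{\mathcal{F}}\le1,\ \|\tilde f\|_{\mathcal{F}}\le 1,\ \|f-\tilde f\|_{\mathcal{F}}\ge\epsilon\Big\}.$$ The norm is $q$-uniformly convex (with $q\ge2$) if there exists $c>0$ such that $\delta_{\mathcal{F}}(\epsilon)\ge c\,\epsilon^q$ for all $\epsilon\in[0,2]$. Regret: for $z_1,\dots,z_T\in\mathcal{Z}$ and $f_1,\dots,f_T\in\mathcal{F}$, $$r_T((z_t)_{t=1,\dots,T},(f_t)_{t=1,\dots,T})=\sum_{t=1}^T\ell(z_t,f_t)-\inf_{f\in\mathcal{F}}\sum_{t=1}^T\ell(z_t,f).$$ Follow-The-Leader (FTL): at each round $t\ge2$ the player plays some $$f_t\in\operatorname*{arg\,min}_{f\in\mathcal{F}}\frac{1}{t-1}\sum_{\tau=1}^{t-1}\ell(z_\tau,f),$$ and $f_1\in\mathcal{F}$ is arbitrary. *)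

theory Defs
  imports "HOL-Analysis.Analysis"
begin

text \<open>The norm of the type class is the Euclidean one, so an arbitrary norm on the space is a
  function argument \<open>N\<close>. Nonnegativity of \<open>N\<close> follows from the three axioms.\<close>

definition is_norm :: "('a::real_vector \<Rightarrow> real) \<Rightarrow> bool" where
  "is_norm N \<longleftrightarrow>
     (\<forall>x. N x = 0 \<longleftrightarrow> x = 0) \<and>
     (\<forall>a x. N (a *\<^sub>R x) = \<bar>a\<bar> * N x) \<and>
     (\<forall>x y. N (x + y) \<le> N x + N y)"

text \<open>The infimum is over a set of reals that is bounded below by 0 and, on a space of positive
  dimension, nonempty whenever \<open>\<epsilon> \<le> 2\<close> (take \<open>g = - f\<close> with \<open>N f = 1\<close>).\<close>

definition modulus_of_convexity :: "('a::real_vector \<Rightarrow> real) \<Rightarrow> real \<Rightarrow> real" where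
  "modulus_of_convexity N \<epsilon> =
     Inf {1 - N ((f + g) /\<^sub>R 2) | f g. N f \<le> 1 \<and> N g \<le> 1 \<and> N (f - g) \<ge> \<epsilon>}"

definition uniformly_convex_norm :: "real \<Rightarrow> ('a::real_vector \<Rightarrow> real) \<Rightarrow> bool" where
  "uniformly_convex_norm q N \<longleftrightarrow>
     is_norm N \<and> q \<ge> 2 \<and>
     (\<exists>c>0. \<forall>\<epsilon>\<in>{0..2}. modulus_of_convexity N \<epsilon> \<ge> c * \<epsilon> powr q)"

definition norm_ball :: "('a::real_vector \<Rightarrow> real) \<Rightarrow> real \<Rightarrow> 'a set" where
  "norm_ball N C = {f. N f \<le> C}"

text \<open>Rounds are numbered from 1 to \<open>T\<close>; values of \<open>z\<close> and \<open>f\<close> at other indices are irrelevant.\<close>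

definition regret ::
    "('z \<Rightarrow> 'f \<Rightarrow> real) \<Rightarrow> 'f set \<Rightarrow> nat \<Rightarrow> (nat \<Rightarrow> 'z) \<Rightarrow> (nat \<Rightarrow> 'f) \<Rightarrow> real" where
  "regret l F T z f = (\<Sum>t=1..T. l (z t) (f t)) - (INF g\<in>F. \<Sum>t=1..T. l (z t) g)"

definition follow_the_leader ::
    "('z \<Rightarrow> 'f \<Rightarrow> real) \<Rightarrow> 'f set \<Rightarrow> nat \<Rightarrow> (nat \<Rightarrow> 'z) \<Rightarrow> (nat \<Rightarrow> 'f) \<Rightarrow> bool" where
  "follow_the_leader l F T z f \<longleftrightarrow>
     f 1 \<in> F \<and>
     (\<forall>t\<in>{2..T}.
        is_arg_min (\<lambda>g. 1 / real (t - 1) * (\<Sum>\<tau>=1..t-1. l (z \<tau>) g)) (\<lambda>g. g \<in> F) (f t))"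

definition linear_loss :: "'a::real_inner \<Rightarrow> 'a \<Rightarrow> real" where
  "linear_loss z f = z \<bullet> f"

end

theory Submission
  imports Defs
begin

text \<open>The be-the-leader inequality bounds the regret by the sum of the \<open>z\<^sub>t \<bullet> (f\<^sub>t - f\<^sub>t\<^sub>+\<^sub>1)\<close>.
  Let \<open>S\<^sub>t = z\<^sub>1 + \<dots> + z\<^sub>t\<close>. The midpoint of \<open>f\<^sub>t\<close> and \<open>f\<^sub>t\<^sub>+\<^sub>1\<close> lies inside the ball at a depth of
  order \<open>N (f\<^sub>t - f\<^sub>t\<^sub>+\<^sub>1)\<^sup>q\<close>, so it can be pushed that far in a direction \<open>- u\<close> with
  \<open>u \<bullet> z \<ge> b > 0\<close> on \<open>Z\<close>, which decreases the loss \<open>S\<^sub>t\<close> by at least \<open>t b\<close> times that depth.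
  Minimality of \<open>f\<^sub>t\<^sub>+\<^sub>1\<close> for \<open>S\<^sub>t\<close> and of \<open>f\<^sub>t\<close> for \<open>S\<^sub>t\<^sub>-\<^sub>1\<close> then gives
  \<open>t N (f\<^sub>t - f\<^sub>t\<^sub>+\<^sub>1)\<^sup>q = O(z\<^sub>t \<bullet> (f\<^sub>t - f\<^sub>t\<^sub>+\<^sub>1)) = O(N (f\<^sub>t - f\<^sub>t\<^sub>+\<^sub>1))\<close>, and the
  regret is of the order of the sum of the \<open>t\<^bsup>-1/(q-1)\<^esup>\<close>.\<close>

section \<open>Arbitrary norms on a Euclidean space\<close>

lemma is_normD:
  assumes "is_norm N"
  shows "N x = 0 \<longleftrightarrow> x = 0" "N (a *\<^sub>R x) = \<bar>a\<bar> * N x" "N (x + y) \<le> N x + N y"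
  using assms unfolding is_norm_def by auto

lemma is_norm_minus: "is_norm N \<Longrightarrow> N (- x) = N x"
  using is_normD(2)[of N "-1" x] by simp

lemma is_norm_diff_le: "is_norm N \<Longrightarrow> N (x - y) \<le> N x + N y"
  using is_normD(3)[of N x "- y"] by (simp add: is_norm_minus)

lemma is_norm_nonneg:
  assumes "is_norm N" shows "0 \<le> N x"
  using is_norm_diff_le[OF assms, of x x] is_normD(1)[OF assms, of 0] by simp

lemma is_norm_pos: "is_norm N \<Longrightarrow> x \<noteq> 0 \<Longrightarrow> 0 < N x"
  using is_norm_nonneg[of N x] is_normD(1)[of N x] by simp

lemma is_norm_continuous:
  fixes N :: "'a::euclidean_space \<Rightarrow> real"
  assumes "is_norm N"
  shows "continuous_on UNIV N"
proof (rule convex_on_continuous)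
  show "convex_on UNIV N"
  proof
    fix t :: real and x y :: 'a
    assume "0 < t" "t < 1"
    then show "N ((1 - t) *\<^sub>R x + t *\<^sub>R y) \<le> (1 - t) * N x + t * N y"
      using is_normD(3)[OF assms, of "(1 - t) *\<^sub>R x" "t *\<^sub>R y"] is_normD(2)[OF assms] by simp
  qed simp
qed simp

text \<open>By continuity \<open>N\<close> attains a minimum on the compact Euclidean unit sphere,
  and that minimum is positive; its reciprocal serves as \<open>L\<close>, by homogeneity.\<close>

lemma is_norm_ge_norm:
  fixes N :: "'a::euclidean_space \<Rightarrow> real"
  assumes "is_norm N"
  obtains L where "L > 0" "\<And>x. norm x \<le> L * N x"
proof -
  have "\<exists>m\<in>sphere 0 1. \<forall>x\<in>sphere (0::'a) 1. N m \<le> N x"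
    by (rule continuous_attains_inf)
       (auto intro: continuous_on_subset[OF is_norm_continuous[OF assms]])
  then obtain m :: 'a where m: "norm m = 1" "\<And>x. norm x = 1 \<Longrightarrow> N m \<le> N x"
    by auto
  have "N m > 0"
    using m(1) by (intro is_norm_pos[OF assms]) auto
  show thesis
  proof
    show "1 / N m > 0" using \<open>N m > 0\<close> by simp
    fix x
    show "norm x \<le> 1 / N m * N x"
    proof (cases "x = 0")
      case True
      then show ?thesis using is_norm_nonneg[OF assms, of x] \<open>N m > 0\<close> by simp
    next
      case False
      then have "N m \<le> N (x /\<^sub>R norm x)" by (intro m(2)) simp
      also have "\<dots> = N x / norm x"
        using is_normD(2)[OF assms] by (simp add: divide_inverse)
      finally show ?thesis using False \<open>N m > 0\<close> by (simp add: field_simps)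
    qed
  qed
qed

lemma compact_norm_ball:
  fixes N :: "'a::euclidean_space \<Rightarrow> real"
  assumes "is_norm N"
  shows "compact (norm_ball N C)"
proof -
  obtain L where L: "L > 0" "\<And>x. norm x \<le> L * N x"
    using is_norm_ge_norm[OF assms] by metis
  have "closed (norm_ball N C)"
    unfolding norm_ball_def
    by (intro closed_Collect_le is_norm_continuous assms continuous_on_const)
  moreover have "bounded (norm_ball N C)"
  proof (rule boundedI)
    fix x assume "x \<in> norm_ball N C"
    then have "L * N x \<le> L * C" using L(1) by (simp add: norm_ball_def)
    then show "norm x \<le> L * C" using L(2)[of x] by linarith
  qed
  ultimately show ?thesis by (simp add: compact_eq_bounded_closed)
qed

section \<open>Uniform convexity and growth of linear losses on the ball\<close>

lemma modulus_of_convexity_le: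
  assumes "is_norm N" "N f \<le> 1" "N g \<le> 1"
  shows "modulus_of_convexity N (N (f - g)) \<le> 1 - N ((f + g) /\<^sub>R 2)"
  unfolding modulus_of_convexity_def
proof (rule cInf_lower)
  show "bdd_below {1 - N ((f' + g') /\<^sub>R 2) | f' g'. N f' \<le> 1 \<and> N g' \<le> 1 \<and> N (f - g) \<le> N (f' - g')}"
  proof (rule bdd_belowI[of _ 0], clarify)
    fix f' g' assume "N f' \<le> 1" "N g' \<le> 1"
    then show "0 \<le> 1 - N ((f' + g') /\<^sub>R 2)"
      using is_normD(2)[OF assms(1), of "1/2" "f' + g'"] is_normD(3)[OF assms(1), of f' g']
      by simp
  qed
qed (use assms in auto)

text \<open>Dividing by \<open>C\<close> moves both points to the unit ball, where their distance is
  at most 2. Scaling back turns the depth \<open>c * (N (f - g) / C) powr q\<close> into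
  \<open>C\<close> times it, whence the factor \<open>C powr (1 - q)\<close>. The constant
  \<open>c\<close> is fixed before \<open>C\<close>.\<close>

lemma uniformly_convex_midpoint:
  assumes "uniformly_convex_norm q N"
  obtains c where "c > 0" "\<And>C f g. C > 0 \<Longrightarrow> f \<in> norm_ball N C \<Longrightarrow> g \<in> norm_ball N C \<Longrightarrow>
      N ((f + g) /\<^sub>R 2) \<le> C - c * C powr (1 - q) * N (f - g) powr q"
proof -
  have N: "is_norm N" using assms by (simp add: uniformly_convex_norm_def)
  obtain c where c: "c > 0" "\<And>e. 0 \<le> e \<Longrightarrow> e \<le> 2 \<Longrightarrow> c * e powr q \<le> modulus_of_convexity N e"
    using assms by (auto simp: uniformly_convex_norm_def)
  show thesis
  proof (rule that[OF c(1)])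
    fix C f g
    assume "C > 0" and fg: "f \<in> norm_ball N C" "g \<in> norm_ball N C"
    have sc: "N (x /\<^sub>R C) = N x / C" for x
      using \<open>C > 0\<close> by (simp add: is_normD(2)[OF N] field_simps)
    have 1: "N (f /\<^sub>R C) \<le> 1" "N (g /\<^sub>R C) \<le> 1"
      using fg \<open>C > 0\<close> by (auto simp: sc norm_ball_def)
    have d: "N (f /\<^sub>R C - g /\<^sub>R C) = N (f - g) / C"
      using sc[of "f - g"] by (simp add: scaleR_diff_right)
    have "(f /\<^sub>R C + g /\<^sub>R C) /\<^sub>R 2 = ((f + g) /\<^sub>R 2) /\<^sub>R C"
      by (simp add: scaleR_add_right mult.commute)
    then have m: "N ((f /\<^sub>R C + g /\<^sub>R C) /\<^sub>R 2) = N ((f + g) /\<^sub>R 2) / C"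
      by (simp only: sc)
    have "c * (N (f - g) / C) powr q \<le> modulus_of_convexity N (N (f /\<^sub>R C - g /\<^sub>R C))"
      unfolding d[symmetric] using is_norm_diff_le[OF N, of "f /\<^sub>R C" "g /\<^sub>R C"] 1
      by (intro c is_norm_nonneg[OF N]) linarith
    also have "\<dots> \<le> 1 - N ((f + g) /\<^sub>R 2) / C"
      using modulus_of_convexity_le[OF N 1] by (simp only: m)
    finally have "N ((f + g) /\<^sub>R 2) \<le> C - c * (C * (N (f - g) / C) powr q)"
      using \<open>C > 0\<close> by (simp add: field_simps)
    also have "C * (N (f - g) / C) powr q = C powr (1 - q) * N (f - g) powr q"
      using \<open>C > 0\<close> is_norm_nonneg[OF N, of "f - g"] by (simp add: powr_divide powr_diff)
    finally show "N ((f + g) /\<^sub>R 2) \<le> C - c * C powr (1 - q) * N (f - g) powr q"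
      by (simp add: mult.assoc)
  qed
qed

lemma minimizer_growth:
  fixes N :: "'a::real_inner \<Rightarrow> real"
  assumes N: "is_norm N" and "u \<noteq> 0" "0 \<le> \<delta>"
    and mid: "N ((f + g) /\<^sub>R 2) \<le> C - \<delta>"
    and min: "\<And>h. h \<in> norm_ball N C \<Longrightarrow> s \<bullet> g \<le> s \<bullet> h"
  shows "2 * \<delta> * (s \<bullet> u) / N u \<le> s \<bullet> (f - g)"
proof -
  \<comment> \<open>The shift has \<open>N\<close>-length \<open>\<delta>\<close>, so the triangle
    inequality keeps \<open>?h\<close> in the ball; twice the inequality between
    \<open>s \<bullet> g\<close> and \<open>s \<bullet> ?h\<close> is the claim.\<close>
  let ?h = "(f + g) /\<^sub>R 2 - (\<delta> / N u) *\<^sub>R u"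
  have "N u > 0" using is_norm_pos[OF N \<open>u \<noteq> 0\<close>] .
  then have "N ((\<delta> / N u) *\<^sub>R u) = \<delta>"
    using \<open>0 \<le> \<delta>\<close> by (simp add: is_normD(2)[OF N])
  then have "?h \<in> norm_ball N C"
    using is_norm_diff_le[OF N, of "(f + g) /\<^sub>R 2" "(\<delta> / N u) *\<^sub>R u"] mid
    by (simp add: norm_ball_def)
  from min[OF this] show ?thesis
    by (simp add: inner_diff_right inner_add_right field_simps)
qed

text \<open>For positive \<open>x\<close>, cancel one factor \<open>x\<close> and take the root of
  order \<open>q - 1\<close>.\<close>

lemma powr_bound_of_mult_powr_le:
  fixes x t a m q :: real
  assumes "0 \<le> x" "0 < t" "0 < a" "1 < q" "a * t * x powr q \<le> m * x" "0 \<le> m"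
  shows "x \<le> (m / a) powr (1 / (q - 1)) * t powr (- (1 / (q - 1)))"
proof (cases "x = 0")
  case False
  with \<open>0 \<le> x\<close> have "x > 0" by simp
  then have "x powr q = x powr (q - 1) * x" by (simp add: powr_diff)
  with assms(5) have "(a * t * x powr (q - 1)) * x \<le> m * x" by (simp add: mult.assoc)
  then have "a * t * x powr (q - 1) \<le> m" using \<open>x > 0\<close> by simp
  then have "x powr (q - 1) \<le> m / (a * t)" using assms by (simp add: field_simps)
  then have "(x powr (q - 1)) powr (1 / (q - 1)) \<le> (m / (a * t)) powr (1 / (q - 1))"
    using assms by (intro powr_mono2) auto
  moreover have "(x powr (q - 1)) powr (1 / (q - 1)) = x"
    using assms \<open>x > 0\<close> by (simp add: powr_powr)
  moreover have "m / (a * t) = (m / a) * inverse t" by (simp add: field_simps)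
  ultimately show ?thesis
    using assms by (simp add: powr_mult powr_minus powr_divide inverse_powr divide_inverse)
qed (use assms in simp)

section \<open>Regret of Follow-The-Leader for linear losses\<close>

text \<open>Induction with \<open>g\<close> arbitrary: the hypothesis is applied to the next leader
  \<open>f (Suc (Suc n))\<close>, which also pays the newly added loss and beats every
  \<open>g\<close> on the full sum.\<close>

lemma be_the_leader:
  fixes z f :: "nat \<Rightarrow> 'a::real_inner"
  assumes "\<And>t g. t \<in> {1..n} \<Longrightarrow> g \<in> F \<Longrightarrow> (\<Sum>\<tau>=1..t. z \<tau>) \<bullet> f (Suc t) \<le> (\<Sum>\<tau>=1..t. z \<tau>) \<bullet> g"
    and "\<And>t. t \<in> {1..n} \<Longrightarrow> f (Suc t) \<in> F" and "g \<in> F"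
  shows "(\<Sum>t=1..n. z t \<bullet> f (Suc t)) \<le> (\<Sum>t=1..n. z t) \<bullet> g"
  using assms
proof (induction n arbitrary: g)
  case (Suc n)
  have "(\<Sum>t=1..n. z t \<bullet> f (Suc t)) \<le> (\<Sum>t=1..n. z t) \<bullet> f (Suc (Suc n))"
    using Suc.prems by (intro Suc.IH) auto
  then have "(\<Sum>t=1..Suc n. z t \<bullet> f (Suc t)) \<le> (\<Sum>t=1..Suc n. z t) \<bullet> f (Suc (Suc n))"
    by (simp add: inner_add_left)
  also have "\<dots> \<le> (\<Sum>t=1..Suc n. z t) \<bullet> g"
    using Suc.prems by (intro Suc.prems(1)) auto
  finally show ?case .
qed simp

text \<open>For \<open>t = 1\<close> the sum is empty, so the arbitrary first play is covered too;
  for later rounds the positive factor \<open>1 / real (t - 1)\<close> cancels.\<close>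

lemma follow_the_leader_linear_lossD:
  assumes "follow_the_leader linear_loss F T z f" "t \<in> {1..T}"
  shows "f t \<in> F" "g \<in> F \<Longrightarrow> (\<Sum>\<tau>=1..t-1. z \<tau>) \<bullet> f t \<le> (\<Sum>\<tau>=1..t-1. z \<tau>) \<bullet> g"
proof -
  consider "t = 1" | "t \<in> {2..T}" using assms(2) by force
  then have "f t \<in> F \<and> (g \<in> F \<longrightarrow> (\<Sum>\<tau>=1..t-1. z \<tau>) \<bullet> f t \<le> (\<Sum>\<tau>=1..t-1. z \<tau>) \<bullet> g)"
  proof cases
    case 2
    then have "is_arg_min (\<lambda>g. 1 / real (t - 1) * (\<Sum>\<tau>=1..t-1. linear_loss (z \<tau>) g))
        (\<lambda>g. g \<in> F) (f t)"
      using assms(1) by (simp add: follow_the_leader_def)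
    moreover have "real (t - 1) > 0" using 2 by simp
    ultimately show ?thesis
      unfolding is_arg_min_def linear_loss_def inner_sum_left[symmetric]
      by (smt (verit) divide_strict_right_mono mult_cancel_right1 times_divide_eq_left)
  qed (use assms(1) in \<open>simp add: follow_the_leader_def\<close>)
  then show "f t \<in> F" "g \<in> F \<Longrightarrow> (\<Sum>\<tau>=1..t-1. z \<tau>) \<bullet> f t \<le> (\<Sum>\<tau>=1..t-1. z \<tau>) \<bullet> g"
    by blast+
qed

lemma follow_the_leader_regret_le:
  fixes F :: "'a::euclidean_space set"
  assumes "compact F" and ftl: "follow_the_leader linear_loss F T z f" and "1 \<le> T"
  obtains h where "\<And>t. t \<in> {1..Suc T} \<Longrightarrow> h t \<in> F"
    and "\<And>t g. t \<in> {1..Suc T} \<Longrightarrow> g \<in> F \<Longrightarrow> (\<Sum>\<tau>=1..t-1. z \<tau>) \<bullet> h t \<le> (\<Sum>\<tau>=1..t-1. z \<tau>) \<bullet> g"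
    and "regret linear_loss F T z f \<le> (\<Sum>t=1..T. z t \<bullet> (h t - h (Suc t)))"
proof -
  have "f 1 \<in> F" using ftl by (simp add: follow_the_leader_def)
  then have "F \<noteq> {}" by blast
  have "\<exists>x\<in>F. \<forall>y\<in>F. (\<Sum>\<tau>=1..T. z \<tau>) \<bullet> x \<le> (\<Sum>\<tau>=1..T. z \<tau>) \<bullet> y"
    by (rule continuous_attains_inf[OF assms(1) \<open>F \<noteq> {}\<close>]) (intro continuous_intros)
  then obtain x where x: "x \<in> F" "\<And>y. y \<in> F \<Longrightarrow> (\<Sum>\<tau>=1..T. z \<tau>) \<bullet> x \<le> (\<Sum>\<tau>=1..T. z \<tau>) \<bullet> y"
    by blast
  \<comment> \<open>The strategy fixes plays only up to round \<open>T\<close>, while be-the-leader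
    also needs a leader after round \<open>T\<close>; the minimizer \<open>x\<close> is appended as
    that play.\<close>
  define h where "h = f(Suc T := x)"
  have h: "h t \<in> F" "\<And>g. g \<in> F \<Longrightarrow> (\<Sum>\<tau>=1..t-1. z \<tau>) \<bullet> h t \<le> (\<Sum>\<tau>=1..t-1. z \<tau>) \<bullet> g"
    if "t \<in> {1..Suc T}" for t
  proof -
    have "h t \<in> F \<and> (\<forall>g\<in>F. (\<Sum>\<tau>=1..t-1. z \<tau>) \<bullet> h t \<le> (\<Sum>\<tau>=1..t-1. z \<tau>) \<bullet> g)"
    proof (cases "t = Suc T")
      case True
      with x show ?thesis by (simp add: h_def)
    next
      case False
      with that have "t \<in> {1..T}" and "h t = f t" by (auto simp: h_def)
      then show ?thesis using follow_the_leader_linear_lossD[OF ftl] by metis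
    qed
    then show "h t \<in> F" "\<And>g. g \<in> F \<Longrightarrow> (\<Sum>\<tau>=1..t-1. z \<tau>) \<bullet> h t \<le> (\<Sum>\<tau>=1..t-1. z \<tau>) \<bullet> g"
      by blast+
  qed
  have "(\<Sum>t=1..T. z t \<bullet> h (Suc t)) \<le> (INF g\<in>F. \<Sum>t=1..T. linear_loss (z t) g)"
  proof (rule cINF_greatest[OF \<open>F \<noteq> {}\<close>])
    fix g assume "g \<in> F"
    then have "(\<Sum>t=1..T. z t \<bullet> h (Suc t)) \<le> (\<Sum>t=1..T. z t) \<bullet> g"
      using h(1)[of "Suc t" for t] h(2)[of "Suc t" for t] by (intro be_the_leader[where F = F]) auto
    then show "(\<Sum>t=1..T. z t \<bullet> h (Suc t)) \<le> (\<Sum>t=1..T. linear_loss (z t) g)"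
      by (simp add: linear_loss_def inner_sum_left)
  qed
  moreover have "(\<Sum>t=1..T. linear_loss (z t) (f t)) = (\<Sum>t=1..T. z t \<bullet> h t)"
    by (rule sum.cong) (auto simp: h_def linear_loss_def)
  ultimately have "regret linear_loss F T z f \<le> (\<Sum>t=1..T. z t \<bullet> (h t - h (Suc t)))"
    by (simp add: regret_def inner_diff_right sum_subtractf)
  with h show thesis by (rule that)
qed

text \<open>The common core of both rates: \<open>K\<close> depends only on \<open>Z\<close>,
  \<open>N\<close>, \<open>q\<close> and \<open>C\<close>, and only the sum of powers remains to be
  estimated.\<close>

lemma follow_the_leader_regret_le_sum_powr:
  fixes Z :: "'a::euclidean_space set" and N :: "'a \<Rightarrow> real"
  assumes "compact Z" "0 \<notin> convex hull Z" "uniformly_convex_norm q N"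
  obtains K where "K > 0"
    "\<And>T z f. 1 \<le> T \<Longrightarrow> (\<And>t. t \<in> {1..T} \<Longrightarrow> z t \<in> Z) \<Longrightarrow>
      follow_the_leader linear_loss (norm_ball N C) T z f \<Longrightarrow>
      regret linear_loss (norm_ball N C) T z f \<le> K * (\<Sum>t=1..T. real t powr (- (1 / (q - 1))))"
proof -
  have N: "is_norm N" and "q \<ge> 2" using assms(3) by (auto simp: uniformly_convex_norm_def)
  obtain c where c: "c > 0" "\<And>C f g. C > 0 \<Longrightarrow> f \<in> norm_ball N C \<Longrightarrow> g \<in> norm_ball N C \<Longrightarrow>
      N ((f + g) /\<^sub>R 2) \<le> C - c * C powr (1 - q) * N (f - g) powr q"
    using uniformly_convex_midpoint[OF assms(3)] by metis
  obtain L where L: "L > 0" "\<And>x. norm x \<le> L * N x"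
    using is_norm_ge_norm[OF N] by metis
  obtain B where B: "B > 0" "\<And>z. z \<in> Z \<Longrightarrow> norm z \<le> B"
    using compact_imp_bounded[OF assms(1)] by (auto simp: bounded_pos)
  have "closed (convex hull Z)"
    using compact_convex_hull[OF assms(1)] by (rule compact_imp_closed)
  \<comment> \<open>Strict separation of 0 from the closed convex hull gives the direction
    \<open>u\<close> and the margin \<open>b\<close>.\<close>
  then obtain u b where u: "u \<noteq> 0" and "b > 0" and "\<forall>x\<in>convex hull Z. u \<bullet> x > b"
    using separating_hyperplane_closed_0[OF convex_convex_hull _ assms(2)] by blast
  then have ub: "b \<le> z \<bullet> u" if "z \<in> Z" for z
    using hull_inc[OF that, of convex] by (force simp: inner_commute)
  have "N u > 0" using is_norm_pos[OF N u] .
  define M where "M = B * L"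
  have "M > 0" using B L by (simp add: M_def)
  have zM: "z \<bullet> x \<le> M * N x" if "z \<in> Z" for z x
  proof -
    have "z \<bullet> x \<le> norm z * norm x" by (rule norm_cauchy_schwarz)
    also have "\<dots> \<le> B * (L * N x)" using B that L by (intro mult_mono) auto
    finally show ?thesis by (simp add: M_def)
  qed
  \<comment> \<open>\<open>A\<close> gathers the constants of \<open>minimizer_growth\<close> with
    depth \<open>c * C powr (1 - q) * ?D powr q\<close> and \<open>?S t \<bullet> u\<close> at least
    \<open>real t * b\<close>. The summand 1 in \<open>K\<close> keeps it positive when
    \<open>C = 0\<close>: then \<open>A\<close>, \<open>M / A\<close> and its power are all 0 by
    convention.\<close>
  define A where "A = 2 * c * C powr (1 - q) * b / N u"
  define K where "K = M * (M / A) powr (1 / (q - 1)) + 1"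
  show thesis
  proof
    show "K > 0" using \<open>M > 0\<close> by (simp add: K_def add_nonneg_pos)
    fix T :: nat and z f :: "nat \<Rightarrow> 'a"
    assume "1 \<le> T" and z: "\<And>t. t \<in> {1..T} \<Longrightarrow> z t \<in> Z"
      and ftl: "follow_the_leader linear_loss (norm_ball N C) T z f"
    obtain h where h: "\<And>t. t \<in> {1..Suc T} \<Longrightarrow> h t \<in> norm_ball N C"
      "\<And>t g. t \<in> {1..Suc T} \<Longrightarrow> g \<in> norm_ball N C \<Longrightarrow> (\<Sum>\<tau>=1..t-1. z \<tau>) \<bullet> h t \<le> (\<Sum>\<tau>=1..t-1. z \<tau>) \<bullet> g"
      and reg: "regret linear_loss (norm_ball N C) T z f \<le> (\<Sum>t=1..T. z t \<bullet> (h t - h (Suc t)))"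
      by (rule follow_the_leader_regret_le[OF compact_norm_ball[OF N] ftl \<open>1 \<le> T\<close>]) blast
    have "z t \<bullet> (h t - h (Suc t)) \<le> K * real t powr (- (1 / (q - 1)))" if t: "t \<in> {1..T}" for t
    proof -
      let ?S = "\<lambda>t. \<Sum>\<tau>=1..t. z \<tau>" and ?D = "N (h t - h (Suc t))"
      have ball: "h t \<in> norm_ball N C" "h (Suc t) \<in> norm_ball N C"
        using h(1) t by auto
      have S: "?S t = ?S (t - 1) + z t"
        using t by (cases t) auto
      have "?D \<le> (M / A) powr (1 / (q - 1)) * real t powr (- (1 / (q - 1)))"
      proof (cases "C > 0")
        case True
        then have "A > 0" using c \<open>b > 0\<close> \<open>N u > 0\<close> by (simp add: A_def)
        have "real t * b = (\<Sum>\<tau>=1..t. b)" by simp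
        also have "\<dots> \<le> (\<Sum>\<tau>=1..t. z \<tau> \<bullet> u)" using t z by (intro sum_mono ub) auto
        finally have "real t * b \<le> ?S t \<bullet> u" by (simp add: inner_sum_left)
        then have "2 * (c * C powr (1 - q) * ?D powr q) * (real t * b) / N u
            \<le> 2 * (c * C powr (1 - q) * ?D powr q) * (?S t \<bullet> u) / N u"
          using c(1) \<open>N u > 0\<close> by (intro divide_right_mono mult_left_mono) auto
        then have "A * real t * ?D powr q \<le> 2 * (c * C powr (1 - q) * ?D powr q) * (?S t \<bullet> u) / N u"
          by (simp add: A_def mult_ac)
        also have "\<dots> \<le> ?S t \<bullet> (h t - h (Suc t))"
          using h(2)[of "Suc t"] t c(1)
          by (intro minimizer_growth[OF N u _ c(2)[OF True ball]]) auto
        \<comment> \<open>Since \<open>h t\<close> minimizes the loss \<open>?S (t - 1)\<close>, the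
          part of the inner product coming from earlier rounds is at most 0.\<close>
        also have "\<dots> \<le> z t \<bullet> (h t - h (Suc t))"
          using h(2)[of t "h (Suc t)"] t ball unfolding S
          by (simp add: inner_diff_right inner_add_left)
        also have "\<dots> \<le> M * ?D" using z t by (intro zM) auto
        finally show ?thesis
          using t \<open>A > 0\<close> \<open>M > 0\<close> \<open>q \<ge> 2\<close> is_norm_nonneg[OF N]
          by (intro powr_bound_of_mult_powr_le) auto
      next
        \<comment> \<open>Here the ball contains at most the origin, so consecutive plays
          coincide.\<close>
        case False
        then have "?D \<le> 0"
          using ball is_norm_diff_le[OF N, of "h t" "h (Suc t)"] by (simp add: norm_ball_def)
        also have "0 \<le> (M / A) powr (1 / (q - 1)) * real t powr (- (1 / (q - 1)))" by simp
        finally show ?thesis .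
      qed
      then have "M * ?D \<le> M * ((M / A) powr (1 / (q - 1)) * real t powr (- (1 / (q - 1))))"
        using \<open>M > 0\<close> by simp
      also have "\<dots> \<le> K * real t powr (- (1 / (q - 1)))"
        by (simp add: K_def distrib_right)
      finally show ?thesis
        using zM[of "z t" "h t - h (Suc t)"] z t by fastforce
    qed
    then have "(\<Sum>t=1..T. z t \<bullet> (h t - h (Suc t))) \<le> (\<Sum>t=1..T. K * real t powr (- (1 / (q - 1))))"
      by (rule sum_mono)
    with reg show "regret linear_loss (norm_ball N C) T z f
        \<le> K * (\<Sum>t=1..T. real t powr (- (1 / (q - 1))))"
      by (simp add: sum_distrib_left)
  qed
qed

section \<open>Growth of sums of negative powers\<close>

lemma harm_le_ln: "1 \<le> n \<Longrightarrow> harm n \<le> 1 + ln (real n)"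
proof (induction n rule: dec_induct)
  case (step n)
  have "ln (real n) - ln (real (Suc n)) \<le> - inverse (real (Suc n))"
    using step ln_diff_le[of "real n" "real (Suc n)"] by (simp add: field_simps)
  with step show ?case by (simp add: harm_Suc)
qed (simp add: harm_def)

lemma powr_le_tangent_at_1:
  fixes x a :: real
  assumes "0 \<le> x" "0 < a" "a < 1"
  shows "x powr a \<le> 1 + a * (x - 1)"
proof -
  \<comment> \<open>Young's inequality for \<open>x powr a\<close> and 1 with the conjugate
    exponents \<open>1 / a\<close> and \<open>1 / (1 - a)\<close>.\<close>
  have "x powr a * 1 \<le> (x powr a) powr (1 / a) / (1 / a) + 1 powr (1 / (1 - a)) / (1 / (1 - a))"
    using assms by (intro Youngs_inequality) auto
  also have "(x powr a) powr (1 / a) = x" using assms by (simp add: powr_powr)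
  finally show ?thesis by (simp add: algebra_simps)
qed

text \<open>A discrete integral comparison: each term is at most the increment of
  \<open>real n powr (1 - p) / (1 - p)\<close>, by the tangent bound at the ratio
  \<open>real n / ?x\<close>, which may be 0.\<close>

lemma sum_powr_minus_le:
  fixes p :: real
  assumes "0 < p" "p < 1"
  shows "(\<Sum>t=1..n. real t powr (- p)) \<le> real n powr (1 - p) / (1 - p)"
proof (induction n)
  case (Suc n)
  let ?x = "real (Suc n)"
  have "real n powr (1 - p) = ?x powr (1 - p) * (real n / ?x) powr (1 - p)"
    by (simp add: powr_divide)
  also have "\<dots> \<le> ?x powr (1 - p) * (1 + (1 - p) * (real n / ?x - 1))"
    using assms by (intro mult_left_mono powr_le_tangent_at_1) auto
  also have "real n / ?x - 1 = - 1 / ?x" by (simp add: field_simps)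
  also have "?x powr (1 - p) * (1 + (1 - p) * (- 1 / ?x))
      = ?x powr (1 - p) - (1 - p) * (?x powr (1 - p) / ?x)"
    by (simp add: algebra_simps)
  also have "?x powr (1 - p) / ?x = ?x powr (- p)"
    using powr_diff[of ?x "1 - p" 1] by simp
  finally have "?x powr (- p) * (1 - p) \<le> ?x powr (1 - p) - real n powr (1 - p)"
    by (simp add: algebra_simps)
  then have "?x powr (- p) \<le> (?x powr (1 - p) - real n powr (1 - p)) / (1 - p)"
    using assms by (simp add: pos_le_divide_eq)
  with Suc.IH show ?case by (simp add: diff_divide_distrib)
qed simp

theorem lemma7:
  fixes Z :: "(real ^ 'd) set"
    and N :: "real ^ 'd \<Rightarrow> real"
    and C q :: real
  assumes "Z \<noteq> {}"
    and "compact Z"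
    and "0 \<notin> convex hull Z"
    and "C \<ge> 0"
    and "uniformly_convex_norm q N"
  shows "\<exists>K>0. \<forall>T\<ge>2. \<forall>z f.
           (\<forall>t\<in>{1..T}. z t \<in> Z) \<longrightarrow>
           follow_the_leader linear_loss (norm_ball N C) T z f \<longrightarrow>
             (q = 2 \<longrightarrow>
                regret linear_loss (norm_ball N C) T z f \<le> K * ln (real T)) \<and>
             (q \<in> {2<..3} \<longrightarrow>
                regret linear_loss (norm_ball N C) T z f \<le> K * real T powr ((q - 2) / (q - 1)))"
proof -
  obtain K where "K > 0" and K: "\<And>T z f. 1 \<le> T \<Longrightarrow> (\<And>t. t \<in> {1..T} \<Longrightarrow> z t \<in> Z) \<Longrightarrow>
      follow_the_leader linear_loss (norm_ball N C) T z f \<Longrightarrow>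
      regret linear_loss (norm_ball N C) T z f \<le> K * (\<Sum>t=1..T. real t powr (- (1 / (q - 1))))"
    using follow_the_leader_regret_le_sum_powr[OF assms(2,3,5)] by metis
  have "q \<ge> 2" using assms(5) by (simp add: uniformly_convex_norm_def)
  show ?thesis
  proof (cases "q = 2")
    case True
    have "(\<Sum>t=1..T. real t powr (- (1 / (q - 1)))) \<le> (1 / ln 2 + 1) * ln (real T)"
      if "T \<ge> 2" for T
    proof -
      have "(\<Sum>t=1..T. real t powr (- (1 / (q - 1)))) = harm T"
        unfolding harm_def True by (intro sum.cong) (auto simp: powr_minus)
      also have "\<dots> \<le> 1 + ln (real T)" using that by (intro harm_le_ln) simp
      \<comment> \<open>The additive 1 is absorbed into the logarithm because \<open>T\<close> is at
        least 2.\<close>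
      also have "1 \<le> 1 / ln 2 * ln (real T)" using that by (simp add: field_simps)
      finally show ?thesis by (simp add: distrib_right)
    qed
    then have "K * (\<Sum>t=1..T. real t powr (- (1 / (q - 1)))) \<le> K * (1 / ln 2 + 1) * ln (real T)"
      if "T \<ge> 2" for T
      using that \<open>K > 0\<close> by (simp add: mult.assoc)
    moreover have "K * (1 / ln 2 + 1) > 0"
      using \<open>K > 0\<close> by (intro mult_pos_pos add_pos_pos) auto
    ultimately show ?thesis
      using True by (intro exI[of _ "K * (1 / ln 2 + 1)"]) (fastforce intro: order_trans[OF K])
  next
    case False
    define p where "p = 1 / (q - 1)"
    have p: "0 < p" "p < 1" "1 - p = (q - 2) / (q - 1)"
      using False \<open>q \<ge> 2\<close> by (auto simp: p_def field_simps)
    have "K * (\<Sum>t=1..T. real t powr (- p)) \<le> K / (1 - p) * real T powr ((q - 2) / (q - 1))" for T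
      using sum_powr_minus_le[OF p(1,2), of T] \<open>K > 0\<close> unfolding p(3)[symmetric]
      by (metis mult_left_mono less_imp_le times_divide_eq_left times_divide_eq_right)
    moreover have "K / (1 - p) > 0" using \<open>K > 0\<close> p(2) by (intro divide_pos_pos) auto
    ultimately show ?thesis
      using False unfolding p_def
      by (intro exI[of _ "K / (1 - 1 / (q - 1))"]) (fastforce intro: order_trans[OF K])
  qed
qed

end
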